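(* Let $n\ge 0$ be an integer. If there exists a graph $G$ that is cospectral with the double star $P_2(1,n)$ but not isomorphic to $P_2(1,n)$, then $n$ is even.
   Context: All graphs are finite, simple and undirected. The spectrum of a graph is the multiset of eigenvalues of its adjacency matrix; two graphs are cospectral if they have the same spectrum. For integers $a,b\ge 0$, the double star $P_2(a,b)$ is the tree obtained from the stars $K_{1,a}$ and $K_{1,b}$ by adding an edge between their center vertices. *)

theory Defs
  imports
    "Graph_Theory.Graph_Theory"
    "Jordan_Normal_Form.Char_Poly"
    "HOL-Computational_Algebra.Fundamental_Theorem_Algebra"
begin

text \<open>
  A finite simple undirected graph is a \<^const>\<open>pair_graph\<close>: a finite vertex set with a symmetric,
  irreflexive set of ordered pairs, so that an undirected edge uv is the pair of arcs
  (u,v) and (v,u).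
\<close>

definition adjacency_mat :: "'a list \<Rightarrow> 'a pair_pre_digraph \<Rightarrow> complex mat" where
  "adjacency_mat vs G = mat (length vs) (length vs)
     (\<lambda>(i, j). if (vs ! i, vs ! j) \<in> parcs G then 1 else 0)"

text \<open>
  The spectrum counts eigenvalues with algebraic multiplicity, which for these symmetric 0/1
  matrices is also the geometric one. Working over the complex numbers keeps all eigenvalues
  without appealing to their being real. The choice of the vertex ordering is immaterial, see
  \<open>graph_spectrum_eq\<close> below.
\<close>

definition graph_spectrum :: "'a pair_pre_digraph \<Rightarrow> complex multiset" where
  "graph_spectrum G =
     proots (char_poly (adjacency_mat (SOME vs. distinct vs \<and> set vs = pverts G) G))"

definition cospectral :: "'a pair_pre_digraph \<Rightarrow> 'b pair_pre_digraph \<Rightarrow> bool" where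
  "cospectral G H \<longleftrightarrow> graph_spectrum G = graph_spectrum H"

definition isomorphic_graphs :: "'a pair_pre_digraph \<Rightarrow> 'b pair_pre_digraph \<Rightarrow> bool" where
  "isomorphic_graphs G H \<longleftrightarrow> digraph_iso (with_proj G) (with_proj H)"

text \<open>The star with \<open>a\<close> leaves; its center is the vertex 0.\<close>

definition star :: "nat \<Rightarrow> nat pair_pre_digraph" where
  "star a = \<lparr> pverts = {0..a}, parcs = {0} \<times> {1..a} \<union> {1..a} \<times> {0} \<rparr>"

definition double_star :: "nat \<Rightarrow> nat \<Rightarrow> (nat + nat) pair_pre_digraph" where
  "double_star a b = \<lparr>
     pverts = Inl ` pverts (star a) \<union> Inr ` pverts (star b),
     parcs = map_prod Inl Inl ` parcs (star a) \<union> map_prod Inr Inr ` parcs (star b)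
       \<union> {(Inl 0, Inr 0), (Inr 0, Inl 0)} \<rparr>"

lemma complete_bipartite_star: "complete_bipartite_digraph 1 a (with_proj (star a))"
  unfolding complete_bipartite_digraph_pair_def
  by (simp add: star_def, rule exI[of _ "{0}"], rule exI[of _ "{1..a}"]) auto

lemma pair_graph_double_star: "pair_graph (double_star a b)"
proof
  show "symmetric (with_proj (double_star a b))"
    unfolding symmetric_def by (auto simp: double_star_def star_def sym_def)
qed (auto simp: double_star_def star_def)

lemma adjacency_mat_carrier [simp]:
  "adjacency_mat vs G \<in> carrier_mat (length vs) (length vs)"
  by (simp add: adjacency_mat_def)

lemma char_poly_adjacency_mat_cong:
  assumes "distinct vs" "distinct ws" "set vs = set ws"
  shows "char_poly (adjacency_mat vs G) = char_poly (adjacency_mat ws G)"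
proof (rule char_poly_similar)
  define n where "n = length vs"
  have n: "length vs = n" "length ws = n"
    using assms distinct_card by (metis n_def)+
  define M :: "'a list \<Rightarrow> 'a list \<Rightarrow> ('a \<Rightarrow> 'a \<Rightarrow> complex) \<Rightarrow> complex mat"
    where "M = (\<lambda>xs ys f. mat n n (\<lambda>(i, j). f (xs ! i) (ys ! j)))"
  have mult: "M xs ys f * M ys zs g = M xs zs (\<lambda>x z. \<Sum>y\<in>set ys. f x y * g y z)"
    if "distinct ys" "length ys = n" for xs ys zs f g
  proof (rule eq_matI)
    fix i j assume "i < dim_row (M xs zs (\<lambda>x z. \<Sum>y\<in>set ys. f x y * g y z))"
      "j < dim_col (M xs zs (\<lambda>x z. \<Sum>y\<in>set ys. f x y * g y z))"
    hence ij: "i < n" "j < n" by (auto simp: M_def)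
    have "bij_betw ((!) ys) {0..<n} (set ys)"
      using bij_betw_nth[OF that(1)] that(2) by (simp add: atLeast0LessThan)
    from sum.reindex_bij_betw[OF this, of "\<lambda>y. f (xs ! i) y * g y (zs ! j)"]
    show "(M xs ys f * M ys zs g) $$ (i, j) = M xs zs (\<lambda>x z. \<Sum>y\<in>set ys. f x y * g y z) $$ (i, j)"
      using ij by (simp add: M_def scalar_prod_def)
  qed (auto simp: M_def)
  have M_cong: "M xs ys f = M xs ys g"
    if "\<And>x y. x \<in> set xs \<Longrightarrow> y \<in> set ys \<Longrightarrow> f x y = g x y" "length xs = n" "length ys = n"
    for xs ys f g
    using that by (intro eq_matI) (auto simp: M_def)
  define e where "e = (\<lambda>x y :: 'a. if x = y then 1 else 0 :: complex)"
  define adj where "adj = (\<lambda>x y. if (x, y) \<in> parcs G then 1 else 0 :: complex)"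
  have one: "M xs xs e = 1\<^sub>m n" if "distinct xs" "length xs = n" for xs
    using that by (intro eq_matI) (auto simp: M_def e_def nth_eq_iff_index_eq)
  have adjM: "adjacency_mat xs G = M xs xs adj" if "length xs = n" for xs
    using that by (auto simp: adjacency_mat_def M_def adj_def)
  have ee: "M xs ys e * M ys xs e = 1\<^sub>m n"
    if "distinct xs" "distinct ys" "length xs = n" "length ys = n" "set xs = set ys" for xs ys
  proof -
    have "M xs ys e * M ys xs e = M xs xs e"
      unfolding mult[OF that(2,4)] using that
    proof (intro M_cong)
      fix x z assume x: "x \<in> set xs"
      have "(\<Sum>y\<in>set ys. e x y * e y z) = (\<Sum>y\<in>set ys. if x = y then e x z else 0)"
        by (intro sum.cong) (auto simp: e_def)
      thus "(\<Sum>y\<in>set ys. e x y * e y z) = e x z" using x that by simp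
    qed auto
    thus ?thesis using one that by simp
  qed
  have "M vs ws e * M ws ws adj * M ws vs e = M vs vs adj"
    unfolding mult[OF assms(2) n(2)] using assms n
    by (intro M_cong) (auto simp: e_def sum.delta if_distrib if_distribR cong: if_cong)
  thus "similar_mat (adjacency_mat vs G) (adjacency_mat ws G)"
    using assms n ee
    by (intro similar_matI[of _ _ "M vs ws e" "M ws vs e" n]) (auto simp: adjM, auto simp: M_def)
qed

lemma graph_spectrum_eq:
  assumes "distinct vs" "set vs = pverts G"
  shows "graph_spectrum G = proots (char_poly (adjacency_mat vs G))"
proof -
  have "distinct (SOME vs. distinct vs \<and> set vs = pverts G)
      \<and> set (SOME vs. distinct vs \<and> set vs = pverts G) = pverts G"
    by (rule someI[of _ vs]) (use assms in auto)
  thus ?thesis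
    unfolding graph_spectrum_def using assms char_poly_adjacency_mat_cong by metis
qed

lemma set_mset_graph_spectrum:
  assumes "distinct vs" "set vs = pverts G"
  shows "set_mset (graph_spectrum G) = {k. eigenvalue (adjacency_mat vs G) k}"
proof -
  have "char_poly (adjacency_mat vs G) \<noteq> 0"
    using degree_monic_char_poly[OF adjacency_mat_carrier, of vs G] by auto
  thus ?thesis
    by (simp add: graph_spectrum_eq[OF assms] eigenvalue_root_char_poly[OF adjacency_mat_carrier])
qed

lemma size_graph_spectrum:
  assumes "finite (pverts G)"
  shows "size (graph_spectrum G) = card (pverts G)"
proof -
  obtain vs where vs: "distinct vs" "set vs = pverts G"
    using finite_distinct_list[OF assms] by blast
  thus ?thesis
    using degree_monic_char_poly[OF adjacency_mat_carrier, of vs G] distinct_card[of vs]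
    by (simp add: graph_spectrum_eq size_proots_complex)
qed

end

theory Submission
  imports Defs "Jordan_Normal_Form.Schur_Decomposition"
begin

text \<open>
  Cospectral graphs have the same number of closed walks of each length. Hence a graph \<open>G\<close> cospectral
  with \<open>P\<^sub>2(1,n)\<close> has \<open>n + 3\<close> vertices and is bipartite, and the matrix \<open>N\<close> of common neighbour
  numbers on one side has the same power sums \<open>p\<^sub>1, p\<^sub>2, p\<^sub>3\<close> as for \<open>P\<^sub>2(1,n)\<close>. From
  \<open>p\<^sub>1\<^sup>3 - 3 p\<^sub>1 p\<^sub>2 + 2 p\<^sub>3 = 0\<close> all 3 by 3 minors of the biadjacency matrix vanish, so up to isolated
  vertices and repeated rows or columns only a path on 4 or 5 vertices, or two disjoint edges,
  remain. If the classes of the path on 4 vertices have sizes \<open>a, b, c, d\<close>, the two other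
  spectral invariants read \<open>ab + bc + cd = n + 2\<close> and \<open>abcd = n\<close>; for odd \<open>n\<close> they force
  \<open>b = c = 1\<close> and \<open>{a, d} = {1, n}\<close>, which is \<open>P\<^sub>2(1,n)\<close> itself. The other two shapes contradict the
  corresponding equations.
\<close>

section \<open>Closed walks and the spectrum\<close>

lemma index_mult_mat_sum:
  assumes "M \<in> carrier_mat n n" "N \<in> carrier_mat n n" "i < n" "j < n"
  shows "(M * N) $$ (i, j) = (\<Sum>l<n. M $$ (i, l) * N $$ (l, j))"
  using assms by (auto simp: scalar_prod_def lessThan_atLeast0)

lemma diag_power_upper_triangular:
  fixes B :: "'a :: comm_semiring_1 mat"
  assumes "B \<in> carrier_mat n n" "upper_triangular B"
  shows "upper_triangular (B ^\<^sub>m k) \<and> (\<forall>i<n. (B ^\<^sub>m k) $$ (i, i) = (B $$ (i, i)) ^ k)"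
proof (induction k)
  case 0
  then show ?case using assms by auto
next
  case (Suc k)
  have C: "B ^\<^sub>m k \<in> carrier_mat n n" using assms by simp
  have entry: "(B ^\<^sub>m Suc k) $$ (i, j) = (\<Sum>l<n. (B ^\<^sub>m k) $$ (i, l) * B $$ (l, j))" if "i < n" "j < n" for i j
    using index_mult_mat_sum[OF C assms(1) that] by simp
  have tri: "(B ^\<^sub>m k) $$ (i, j) = 0" "B $$ (i, j) = 0" if "j < i" "i < n" for i j
    using that Suc assms C by auto
  have "(B ^\<^sub>m Suc k) $$ (i, j) = 0" if "j < i" "i < n" for i j
    unfolding entry[OF \<open>i < n\<close> less_trans[OF that]]
    using that tri by (intro sum.neutral) (metis less_trans lessThan_iff linorder_neqE_nat mult_zero_left mult_zero_right)
  moreover have "(B ^\<^sub>m Suc k) $$ (i, i) = (B $$ (i, i)) ^ Suc k" if "i < n" for i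
  proof -
    have "(B ^\<^sub>m Suc k) $$ (i, i) = (\<Sum>l<n. if l = i then (B $$ (i, i)) ^ Suc k else 0)"
      unfolding entry[OF that that]
    proof (intro sum.cong refl)
      fix l assume "l \<in> {..<n}"
      then show "(B ^\<^sub>m k) $$ (i, l) * B $$ (l, i) = (if l = i then B $$ (i, i) ^ Suc k else 0)"
        using Suc tri that by (cases l i rule: linorder_cases) (auto simp: mult.commute)
    qed
    then show ?thesis using that by simp
  qed
  ultimately show ?case using C assms by (auto simp del: pow_mat.simps simp: pow_mat_dim_square[OF assms(1)])
qed

lemma proots_prod_list_linear:
  fixes es :: "'a :: idom list"
  shows "proots (\<Prod>e\<leftarrow>es. [:- e, 1:]) = mset es"
proof (induction es)
  case (Cons e es)
  have "(\<Prod>e\<leftarrow>es. [:- e, 1:]) \<noteq> 0" by (auto simp: prod_list_zero_iff)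
  then show ?case using Cons by (simp add: proots_mult del: mult_pCons_left)
qed auto

text \<open>The trace is invariant under similarity. After Schur triangularisation, the k-th power
  of the triangular factor carries the k-th powers of the eigenvalues on its diagonal.\<close>

lemma sum_mset_power_proots_char_poly:
  fixes A :: "complex mat"
  assumes A: "A \<in> carrier_mat n n"
  shows "(\<Sum>e\<in>#proots (char_poly A). e ^ k) = (\<Sum>i<n. (A ^\<^sub>m k) $$ (i, i))"
proof -
  obtain es where es: "char_poly A = (\<Prod>e\<leftarrow>es. [:- e, 1:])" "length es = n"
    using char_poly_factorized[OF A] by blast
  obtain B P Q where BPQ: "schur_decomposition A es = (B, P, Q)"
    by (cases "schur_decomposition A es")
  note schur = schur_decomposition[OF A es(1) BPQ]
  then have wit: "similar_mat_wit A B P Q" and tri: "upper_triangular B" and diag: "diag_mat B = es"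
    by auto
  note w = similar_mat_witD2[OF A wit]
  have C: "B ^\<^sub>m k \<in> carrier_mat n n" using w by simp
  \<comment> \<open>Cyclicity of the trace, used below to cancel \<open>P\<close> against
    \<open>Q\<close>.\<close>
  have cyc: "(\<Sum>i<n. (M * N) $$ (i, i)) = (\<Sum>i<n. (N * M) $$ (i, i))"
    if "M \<in> carrier_mat n n" "N \<in> carrier_mat n n" for M N :: "complex mat"
  proof -
    have "(\<Sum>i<n. (M * N) $$ (i, i)) = (\<Sum>i<n. \<Sum>l<n. M $$ (i, l) * N $$ (l, i))"
      using that by (intro sum.cong) (auto simp: index_mult_mat_sum simp del: index_mult_mat)
    also have "\<dots> = (\<Sum>l<n. \<Sum>i<n. N $$ (l, i) * M $$ (i, l))"
      by (subst sum.swap) (simp add: mult.commute)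
    also have "\<dots> = (\<Sum>i<n. (N * M) $$ (i, i))"
      using that by (intro sum.cong) (auto simp: index_mult_mat_sum simp del: index_mult_mat)
    finally show ?thesis .
  qed
  have "(\<Sum>i<n. (A ^\<^sub>m k) $$ (i, i)) = (\<Sum>i<n. (P * (B ^\<^sub>m k * Q)) $$ (i, i))"
    using similar_mat_wit_pow_id[OF wit, of k] assoc_mult_mat[OF w(6) C w(7)] by simp
  also have "\<dots> = (\<Sum>i<n. (B ^\<^sub>m k * Q * P) $$ (i, i))"
    by (rule cyc) (use w C in auto)
  also have "B ^\<^sub>m k * Q * P = B ^\<^sub>m k"
    by (simp only: assoc_mult_mat[OF C w(7) w(6)] w(2) right_mult_one_mat[OF C])
  also have "(\<Sum>i<n. (B ^\<^sub>m k) $$ (i, i)) = (\<Sum>i<n. (es ! i) ^ k)"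
    using diag_power_upper_triangular[OF w(5) tri, of k] w(5)
    by (intro sum.cong) (auto simp: diag[symmetric] diag_mat_def)
  also have "\<dots> = (\<Sum>e\<leftarrow>es. e ^ k)"
    using es(2) by (simp add: sum_list_sum_nth lessThan_atLeast0)
  finally show ?thesis
    by (simp add: es(1) proots_prod_list_linear flip: mset_map sum_mset_sum_list)
qed

text \<open>The entries of the powers of the adjacency matrix, indexed by vertices and valued in
  \<open>nat\<close>: all later counting is free of vertex orderings and complex numbers.\<close>

fun walks :: "'a pair_pre_digraph \<Rightarrow> nat \<Rightarrow> 'a \<Rightarrow> 'a \<Rightarrow> nat" where
  "walks G 0 u v = of_bool (u = v)"
| "walks G (Suc k) u v = (\<Sum>x\<in>pverts G. walks G k u x * of_bool ((x, v) \<in> parcs G))"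

lemma adjacency_mat_power:
  assumes "distinct vs" "set vs = pverts G" "i < length vs" "j < length vs"
  shows "(adjacency_mat vs G ^\<^sub>m k) $$ (i, j) = of_nat (walks G k (vs ! i) (vs ! j))"
  using assms(3-)
proof (induction k arbitrary: j)
  case 0
  then show ?case using assms by (simp add: nth_eq_iff_index_eq adjacency_mat_def)
next
  case (Suc k)
  let ?n = "length vs"
  have C: "adjacency_mat vs G ^\<^sub>m k \<in> carrier_mat ?n ?n" by simp
  have "(adjacency_mat vs G ^\<^sub>m Suc k) $$ (i, j)
      = (\<Sum>l<?n. (adjacency_mat vs G ^\<^sub>m k) $$ (i, l) * adjacency_mat vs G $$ (l, j))"
    using index_mult_mat_sum[OF C adjacency_mat_carrier Suc.prems] by simp
  also have "\<dots> = (\<Sum>l<?n. of_nat (walks G k (vs ! i) (vs ! l) * of_bool ((vs ! l, vs ! j) \<in> parcs G)))"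
    using Suc by (intro sum.cong) (auto simp: adjacency_mat_def)
  also have "\<dots> = of_nat (\<Sum>l<?n. walks G k (vs ! i) (vs ! l) * of_bool ((vs ! l, vs ! j) \<in> parcs G))"
    by simp
  also have "(\<Sum>l<?n. walks G k (vs ! i) (vs ! l) * of_bool ((vs ! l, vs ! j) \<in> parcs G))
     = walks G (Suc k) (vs ! i) (vs ! j)"
    using sum.reindex_bij_betw[OF bij_betw_nth[OF assms(1) refl refl],
      of "\<lambda>x. walks G k (vs ! i) x * of_bool ((x, vs ! j) \<in> parcs G)"] assms by simp
  finally show ?case .
qed

definition closed_walks :: "'a pair_pre_digraph \<Rightarrow> nat \<Rightarrow> nat" where
  "closed_walks G k = (\<Sum>v\<in>pverts G. walks G k v v)"

lemma closed_walks_eq_power_sum: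
  assumes "finite (pverts G)"
  shows "(\<Sum>e\<in>#graph_spectrum G. e ^ k) = of_nat (closed_walks G k)"
proof -
  obtain vs where vs: "distinct vs" "set vs = pverts G"
    using finite_distinct_list[OF assms] by blast
  have "(\<Sum>e\<in>#graph_spectrum G. e ^ k) = (\<Sum>i<length vs. of_nat (walks G k (vs ! i) (vs ! i)))"
    using vs by (simp add: graph_spectrum_eq sum_mset_power_proots_char_poly[OF adjacency_mat_carrier]
      adjacency_mat_power)
  also have "\<dots> = of_nat (closed_walks G k)"
    using sum.reindex_bij_betw[OF bij_betw_nth[OF vs(1) refl refl], of "\<lambda>x. walks G k x x"] vs
    by (simp add: closed_walks_def flip: of_nat_sum)
  finally show ?thesis .
qed

lemma cospectral_closed_walks_eq:
  assumes "cospectral G H" "finite (pverts G)" "finite (pverts H)"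
  shows "closed_walks G k = closed_walks H k"
proof -
  have "of_nat (closed_walks G k) = (of_nat (closed_walks H k) :: complex)"
    using assms by (simp add: cospectral_def flip: closed_walks_eq_power_sum)
  then show ?thesis by (rule of_nat_eq_iff[THEN iffD1])
qed

section \<open>Diophantine conditions\<close>

text \<open>This is the blown-up path with an end class of size 1. Writing b = b' + 2 and d = d' +
  2, the equation becomes c (b' d' + b' + d') = b', which forces d' = 0. The case d = 2 has genuine
  solutions, such as b = 2 with any c, and is excluded by parity.\<close>

lemma path_blowup_arith_unit:
  fixes b c d :: nat
  assumes pos: "b > 0" "c > 0" "d > 0"
    and eq: "b + b * c + c * d = b * c * d + 2" and odd: "odd (b * c * d)"
  shows "b = 1 \<and> c = 1"
proof (cases "b = 1")
  case True
  then show ?thesis using eq by simp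
next
  case False
  then obtain b' c' where b: "b = b' + 2" and c: "c = c' + 1"
    using pos by (metis One_nat_def Suc_leI add.commute le_Suc_ex less_one linorder_neqE_nat
      nat_arith.rule0 numeral_2_eq_2 Suc_lessI)
  have "d \<noteq> 1" using eq b c by auto
  then obtain d' where d: "d = d' + 2"
    using pos by (metis One_nat_def Suc_leI add.commute le_Suc_ex numeral_2_eq_2 Suc_lessI)
  have "d' = 0" using eq unfolding b c d by (simp add: algebra_simps)
  then show ?thesis using odd d by simp
qed

text \<open>If both end classes have at least 2 vertices, then abcd + 2 exceeds ab + bc + cd, as
  expansion around (2, 1, 1, 2) shows. So one end class is a single vertex; reversing the path makes
  the two cases the same.\<close>

lemma path_blowup_arith:
  fixes a b c d n :: nat
  assumes pos: "a > 0" "b > 0" "c > 0" "d > 0"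
    and sum: "a * b + b * c + c * d = n + 2" and prod: "a * b * c * d = n" and "odd n"
  shows "b = 1 \<and> c = 1 \<and> (a = 1 \<or> d = 1)"
proof -
  have "a = 1 \<or> d = 1"
  proof (rule ccontr)
    assume "\<not> ?thesis"
    then obtain a' b' c' d' where "a = a' + 2" "b = b' + 1" "c = c' + 1" "d = d' + 2"
      using pos by (metis One_nat_def Suc_leI add.commute le_Suc_ex numeral_2_eq_2 Suc_lessI)
    then show False using sum prod[symmetric] by (simp add: algebra_simps)
  qed
  then show ?thesis
  proof
    assume "a = 1"
    then show ?thesis
      using path_blowup_arith_unit[of b c d] pos sum \<open>odd n\<close> unfolding prod[symmetric] by simp
  next
    assume "d = 1"
    then show ?thesis
      using path_blowup_arith_unit[of c b a] pos sum \<open>odd n\<close> unfolding prod[symmetric]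
      by (simp add: algebra_simps)
  qed
qed

text \<open>Class sizes of a blown-up path on 5 vertices. With all sizes 1 the two sides are 4 and
  5, and the right side stays ahead as the sizes grow.\<close>

lemma path5_blowup_arith:
  fixes a b c d e :: nat
  assumes pos: "a > 0" "b > 0" "c > 0" "d > 0" "e > 0"
    and eq: "b * (a + c) + d * (c + e) = b * d * (a * c + a * e + c * e) + 2"
  shows False
proof -
  obtain a' b' c' d' e' where "a = Suc a'" "b = Suc b'" "c = Suc c'" "d = Suc d'" "e = Suc e'"
    using pos by (metis gr0_implies_Suc)
  then show False using eq by (simp add: algebra_simps)
qed

text \<open>Two disjoint column classes of sizes \<open>u\<close>, \<open>w\<close>, with
  \<open>k1\<close>, \<open>k2\<close>, \<open>k3\<close> rows equal to the first, the second and
  their union. The nonempty classes form the path \<open>k1\<close>, \<open>u\<close>,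
  \<open>k3\<close>, \<open>w\<close>, \<open>k2\<close>, which loses an end when \<open>k1\<close>
  or \<open>k2\<close> is 0 and falls into two complete bipartite graphs when \<open>k3\<close> is
  0.\<close>

lemma three_class_arith:
  fixes u w k1 k2 k3 n :: nat
  assumes "u > 0" "w > 0"
    and sum: "u * (k1 + k3) + w * (k2 + k3) = n + 2"
    and prod: "u * w * (k1 * k2 + k1 * k3 + k2 * k3) = n" and "odd n"
  shows "k2 = 0 \<and> u = 1 \<and> k3 = 1 \<and> (k1 = 1 \<or> w = 1) \<or>
         k1 = 0 \<and> w = 1 \<and> k3 = 1 \<and> (k2 = 1 \<or> u = 1)"
proof -
  have "n > 0" using \<open>odd n\<close> by (rule odd_pos)
  consider "k1 > 0" "k2 > 0" "k3 > 0" | "k3 = 0" | "k2 = 0" "k3 > 0" | "k1 = 0" "k3 > 0" by blast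
  then show ?thesis
  proof cases
    case 1
    then show ?thesis
      using path5_blowup_arith[of k1 u k3 w k2] assms by (simp add: algebra_simps)
  next
    case 2
    then have "u * k1 > 0" "w * k2 > 0" using prod \<open>n > 0\<close> by auto
    \<comment> \<open>Two components with p + 1 and q + 1 edges: the sum would have to equal the
      product plus 2.\<close>
    then obtain p q where "u * k1 = Suc p" "w * k2 = Suc q" by (metis gr0_implies_Suc)
    moreover have "n = (u * k1) * (w * k2)" using prod 2 by (simp add: algebra_simps)
    ultimately show ?thesis using sum 2 by simp
  next
    case 3
    then have "k1 > 0" using prod \<open>n > 0\<close> by auto
    then show ?thesis using path_blowup_arith[of k1 u k3 w n] assms 3 by (simp add: algebra_simps)
  next
    case 4
    then have "k2 > 0" using prod \<open>n > 0\<close> by auto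
    then show ?thesis using path_blowup_arith[of k2 w k3 u n] assms 4 by (simp add: algebra_simps)
  qed
qed

section \<open>Vanishing 3 by 3 minors\<close>

definition det3 :: "('b \<Rightarrow> real) \<Rightarrow> ('b \<Rightarrow> real) \<Rightarrow> ('b \<Rightarrow> real) \<Rightarrow> 'b \<Rightarrow> 'b \<Rightarrow> 'b \<Rightarrow> real" where
  "det3 f g h x y z = f x * (g y * h z - g z * h y) - f y * (g x * h z - g z * h x)
     + f z * (g x * h y - g y * h x)"

text \<open>Cauchy-Binet: the bracket is the Gram determinant of \<open>f\<close>, \<open>g\<close>,
  \<open>h\<close>. Ordered column triples count each minor 6 times, and repeated columns contribute
  0.\<close>

lemma sum_det3_square:
  fixes f g h :: "'b \<Rightarrow> real"
  assumes "finite X"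
  defines "ip \<equiv> \<lambda>p q. \<Sum>x\<in>X. p x * q x"
  shows "(\<Sum>x\<in>X. \<Sum>y\<in>X. \<Sum>z\<in>X. (det3 f g h x y z)\<^sup>2)
    = 6 * (ip f f * ip g g * ip h h + 2 * ip f g * ip g h * ip f h
      - ip f f * (ip g h)\<^sup>2 - ip g g * (ip f h)\<^sup>2 - ip h h * (ip f g)\<^sup>2)"
proof -
  have T: "(\<Sum>x\<in>X. \<Sum>y\<in>X. \<Sum>z\<in>X. p x * q y * r z) = sum p X * sum q X * sum r X"
    for p q r :: "'b \<Rightarrow> real"
    by (simp flip: sum_distrib_left sum_distrib_right)
  \<comment> \<open>The 36 products of Leibniz terms, each arranged as a function of x times one of
    y times one of z, so that \<open>T\<close> factors its sum.\<close>
  have "(det3 f g h x y z)\<^sup>2 =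
      ((f x * f x) * (g y * g y) * (h z * h z) +
       (f x * h x) * (f y * g y) * (g z * h z) +
       (f x * g x) * (g y * h y) * (f z * h z) +
       (f x * f x) * (h y * h y) * (g z * g z) +
       (f x * g x) * (f y * h y) * (g z * h z) +
       (f x * h x) * (g y * h y) * (f z * g z) +
       (f x * g x) * (f y * h y) * (g z * h z) +
       (g x * g x) * (f y * f y) * (h z * h z) +
       (g x * h x) * (f y * g y) * (f z * h z) +
       (f x * h x) * (f y * g y) * (g z * h z) +
       (h x * h x) * (f y * f y) * (g z * g z) +
       (g x * h x) * (f y * h y) * (f z * g z) +
       (f x * g x) * (g y * h y) * (f z * h z) +
       (g x * h x) * (f y * h y) * (f z * g z) +
       (g x * g x) * (h y * h y) * (f z * f z) +
       (f x * h x) * (g y * h y) * (f z * g z) +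
       (g x * h x) * (f y * g y) * (f z * h z) +
       (h x * h x) * (g y * g y) * (f z * f z)) -
      ((f x * f x) * (g y * h y) * (g z * h z) +
       (f x * g x) * (f y * g y) * (h z * h z) +
       (f x * h x) * (g y * g y) * (f z * h z) +
       (f x * f x) * (g y * h y) * (g z * h z) +
       (f x * h x) * (f y * h y) * (g z * g z) +
       (f x * g x) * (h y * h y) * (f z * g z) +
       (f x * g x) * (f y * g y) * (h z * h z) +
       (g x * h x) * (f y * f y) * (g z * h z) +
       (g x * g x) * (f y * h y) * (f z * h z) +
       (f x * h x) * (f y * h y) * (g z * g z) +
       (g x * h x) * (f y * f y) * (g z * h z) +
       (h x * h x) * (f y * g y) * (f z * g z) +
       (f x * g x) * (h y * h y) * (f z * g z) +
       (g x * g x) * (f y * h y) * (f z * h z) +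
       (g x * h x) * (g y * h y) * (f z * f z) +
       (f x * h x) * (g y * g y) * (f z * h z) +
       (h x * h x) * (f y * g y) * (f z * g z) +
       (g x * h x) * (g y * h y) * (f z * f z))" for x y z
    by (simp add: det3_def power2_eq_square algebra_simps)
  then show ?thesis
    by (simp only: sum.distrib sum_subtractf T ip_def) (simp add: algebra_simps power2_eq_square)
qed

text \<open>Newton's identity: the summand is the principal minor of \<open>N\<close> at i, j, k, so
  for finite \<open>Y\<close> the left side is 6 times the third elementary symmetric function of
  the eigenvalues, while \<open>p1\<close>, \<open>p2\<close>, \<open>p3\<close> are the traces of
  the first three powers.\<close>

lemma sum_gram_det3:
  fixes N :: "'b \<Rightarrow> 'b \<Rightarrow> real" and Y :: "'b set"
  assumes sym: "\<And>i j. N i j = N j i"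
  defines "p1 \<equiv> \<Sum>i\<in>Y. N i i"
    and "p2 \<equiv> \<Sum>i\<in>Y. \<Sum>j\<in>Y. N i j * N j i"
    and "p3 \<equiv> \<Sum>i\<in>Y. \<Sum>j\<in>Y. \<Sum>k\<in>Y. N i j * N j k * N k i"
  shows "(\<Sum>i\<in>Y. \<Sum>j\<in>Y. \<Sum>k\<in>Y. N i i * N j j * N k k + 2 * (N i j * N j k * N k i)
      - N i i * (N j k)\<^sup>2 - N j j * (N k i)\<^sup>2 - N k k * (N i j)\<^sup>2)
    = p1 ^ 3 - 3 * p1 * p2 + 2 * p3"
proof -
  have p2: "p2 = (\<Sum>i\<in>Y. \<Sum>j\<in>Y. (N i j)\<^sup>2)"
    unfolding p2_def by (simp add: power2_eq_square sym)
  have a: "(\<Sum>i\<in>Y. \<Sum>j\<in>Y. \<Sum>k\<in>Y. N i i * N j j * N k k) = p1 ^ 3"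
    by (simp add: p1_def power3_eq_cube flip: sum_distrib_left sum_distrib_right)
  have b: "(\<Sum>i\<in>Y. \<Sum>j\<in>Y. \<Sum>k\<in>Y. N i i * (N j k)\<^sup>2) = p1 * p2"
    by (simp add: p1_def p2 flip: sum_distrib_left sum_distrib_right)
  have c: "(\<Sum>i\<in>Y. \<Sum>j\<in>Y. \<Sum>k\<in>Y. N k k * (N i j)\<^sup>2) = p1 * p2"
    by (simp add: p1_def p2 mult.commute flip: sum_distrib_left sum_distrib_right)
  have "(\<Sum>i\<in>Y. \<Sum>j\<in>Y. \<Sum>k\<in>Y. N j j * (N k i)\<^sup>2) = (\<Sum>i\<in>Y. \<Sum>k\<in>Y. \<Sum>j\<in>Y. N j j * (N i k)\<^sup>2)"
    by (rule sum.cong[OF refl], subst sum.swap) (simp add: sym)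
  also note c
  finally have d: "(\<Sum>i\<in>Y. \<Sum>j\<in>Y. \<Sum>k\<in>Y. N j j * (N k i)\<^sup>2) = p1 * p2" .
  have e: "(\<Sum>i\<in>Y. \<Sum>j\<in>Y. \<Sum>k\<in>Y. 2 * (N i j * N j k * N k i)) = 2 * p3"
    by (simp only: p3_def sum_distrib_left)
  show ?thesis
    by (simp only: sum.distrib sum_subtractf a b c d e)
qed

text \<open>The indicators of \<open>S\<close> and \<open>T\<close> are independent, so that of
  \<open>Z\<close> is a linear combination of them; the alternatives are the combinations with
  values 0 and 1.\<close>

lemma dependent_set_triple:
  assumes det: "\<And>x y z. det3 (\<lambda>x. of_bool (x \<in> S)) (\<lambda>x. of_bool (x \<in> T)) (\<lambda>x. of_bool (x \<in> Z)) x y z = 0"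
    and "S \<noteq> T" "S \<noteq> {}" "T \<noteq> {}"
  shows "Z \<in> {{}, S, T} \<or> S \<inter> T = {} \<and> Z = S \<union> T \<or> T \<subseteq> S \<and> Z = S - T \<or> S \<subseteq> T \<and> Z = T - S"
proof -
  note D = det[unfolded det3_def]
  \<comment> \<open>Columns p, q in which the indicators of \<open>S\<close> and \<open>T\<close>
    form an invertible 2 by 2 matrix; membership of p and q in \<open>Z\<close> then fixes the
    coefficients.\<close>
  consider (a) p q where "p \<in> S - T" "q \<in> T - S" | (b) p q where "T \<subseteq> S" "p \<in> S - T" "q \<in> T"
    | (c) p q where "S \<subseteq> T" "p \<in> S" "q \<in> T - S"
    using assms(2-) by blast
  then show ?thesis
  proof cases
    case a
    define P Q where "P \<longleftrightarrow> p \<in> Z" and "Q \<longleftrightarrow> q \<in> Z"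
    \<comment> \<open>Here \<open>P\<close> and \<open>Q\<close> are the coefficients themselves;
      both being 1 would give the value 2 on the intersection.\<close>
    have *: "(x \<in> Z \<longleftrightarrow> x \<in> S \<and> P \<or> x \<in> T \<and> Q) \<and> \<not> (x \<in> S \<inter> T \<and> P \<and> Q)" for x
      using D[of p q x] a unfolding P_def Q_def
      by (cases "p \<in> Z"; cases "q \<in> Z"; cases "x \<in> Z"; cases "x \<in> S"; cases "x \<in> T") auto
    have "Z = {x \<in> S. P} \<union> {x \<in> T. Q}" using * by blast
    moreover have "S \<inter> T = {}" if P Q using * that by blast
    ultimately show ?thesis by (cases P; cases Q) simp_all
  next
    case b
    define P Q where "P \<longleftrightarrow> p \<in> Z" and "Q \<longleftrightarrow> q \<in> Z"
    have *: "x \<in> Z \<longleftrightarrow> (if x \<in> T then Q else x \<in> S \<and> P)" for x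
      using D[of p q x] b unfolding P_def Q_def
      by (cases "p \<in> Z"; cases "q \<in> Z"; cases "x \<in> Z"; cases "x \<in> S"; cases "x \<in> T") auto
    have "Z = {x \<in> S - T. P} \<union> {x \<in> T. Q}" using * b(1) by (auto split: if_splits)
    then show ?thesis using b(1) by (cases P; cases Q) auto
  next
    case c
    define P Q where "P \<longleftrightarrow> p \<in> Z" and "Q \<longleftrightarrow> q \<in> Z"
    have *: "x \<in> Z \<longleftrightarrow> (if x \<in> S then P else x \<in> T \<and> Q)" for x
      using D[of p q x] c unfolding P_def Q_def
      by (cases "p \<in> Z"; cases "q \<in> Z"; cases "x \<in> Z"; cases "x \<in> S"; cases "x \<in> T") auto
    have "Z = {x \<in> S. P} \<union> {x \<in> T - S. Q}" using * c(1) by (auto split: if_splits)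
    then show ?thesis using c(1) by (cases P; cases Q) auto
  qed
qed

lemma sum3_nonneg_eq_0:
  fixes f :: "'b \<Rightarrow> 'b \<Rightarrow> 'b \<Rightarrow> real"
  assumes "finite A" "\<And>i j k. f i j k \<ge> 0" "(\<Sum>i\<in>A. \<Sum>j\<in>A. \<Sum>k\<in>A. f i j k) = 0"
    and "i \<in> A" "j \<in> A" "k \<in> A"
  shows "f i j k = 0"
proof -
  have "(\<Sum>j\<in>A. \<Sum>k\<in>A. f i j k) = 0"
    using assms(1-4) by (subst (asm) sum_nonneg_eq_0_iff) (auto intro!: sum_nonneg)
  then have "(\<Sum>k\<in>A. f i j k) = 0"
    using assms by (subst (asm) sum_nonneg_eq_0_iff) (auto intro!: sum_nonneg)
  then show ?thesis
    using assms by (subst (asm) sum_nonneg_eq_0_iff) auto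
qed

text \<open>If the matrix \<open>N\<close> of intersection numbers has eigenvalues \<open>\<theta>\<^sub>i\<close>, the hypothesis on the
  power sums says that their third elementary symmetric function vanishes. It is the sum of the
  Gram determinants of the triples of rows, hence of the squares of all 3 by 3 minors.\<close>

lemma det3_eq_0_if_power_sums:
  fixes R :: "'a \<Rightarrow> 'b set"
  assumes fin: "finite X" "finite Y" and R: "\<And>y. R y \<subseteq> X"
  defines "N \<equiv> \<lambda>y z. card (R y \<inter> R z)"
  assumes p: "(\<Sum>i\<in>Y. N i i) ^ 3 + 2 * (\<Sum>i\<in>Y. \<Sum>j\<in>Y. \<Sum>k\<in>Y. N i j * N j k * N k i)
    = 3 * (\<Sum>i\<in>Y. N i i) * (\<Sum>i\<in>Y. \<Sum>j\<in>Y. N i j * N j i)"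
    and ijk: "i \<in> Y" "j \<in> Y" "k \<in> Y"
  shows "det3 (\<lambda>x. of_bool (x \<in> R i)) (\<lambda>x. of_bool (x \<in> R j)) (\<lambda>x. of_bool (x \<in> R k)) x y z = 0"
proof -
  define r :: "'a \<Rightarrow> 'b \<Rightarrow> real" where "r = (\<lambda>y x. of_bool (x \<in> R y))"
  define d where "d = (\<lambda>i j k. \<Sum>x\<in>X. \<Sum>y\<in>X. \<Sum>z\<in>X. (det3 (r i) (r j) (r k) x y z)\<^sup>2)"
  have N: "(\<Sum>x\<in>X. r y x * r z x) = real (N y z)" for y z
  proof -
    have "(\<Sum>x\<in>X. r y x * r z x) = (\<Sum>x\<in>X. if x \<in> R y \<inter> R z then 1 else 0)"
      by (intro sum.cong) (auto simp: r_def)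
    also have "\<dots> = real (N y z)"
    proof -
      have "X \<inter> {x. x \<in> R y \<inter> R z} = R y \<inter> R z" using R[of y] by auto
      then show ?thesis using fin by (simp only: sum.If_cases) (simp add: N_def)
    qed
    finally show ?thesis .
  qed
  have "(\<Sum>i\<in>Y. \<Sum>j\<in>Y. \<Sum>k\<in>Y. d i j k) = 6 * (\<Sum>i\<in>Y. \<Sum>j\<in>Y. \<Sum>k\<in>Y.
      real (N i i) * real (N j j) * real (N k k) + 2 * (real (N i j) * real (N j k) * real (N k i))
      - real (N i i) * (real (N j k))\<^sup>2 - real (N j j) * (real (N k i))\<^sup>2
      - real (N k k) * (real (N i j))\<^sup>2)"
  proof -
    have "N k i = N i k" for i k by (simp add: N_def Int_commute)
    then show ?thesis
      unfolding d_def sum_det3_square[OF fin(1)] N sum_distrib_left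
      by (intro sum.cong refl) (simp add: algebra_simps)
  qed
  also have "\<dots> = 6 * (real ((\<Sum>i\<in>Y. N i i) ^ 3 + 2 * (\<Sum>i\<in>Y. \<Sum>j\<in>Y. \<Sum>k\<in>Y. N i j * N j k * N k i))
    - real (3 * (\<Sum>i\<in>Y. N i i) * (\<Sum>i\<in>Y. \<Sum>j\<in>Y. N i j * N j i)))"
    by (subst sum_gram_det3) (simp_all add: N_def Int_commute)
  also have "\<dots> = 0" unfolding p by simp
  finally have "d i j k = 0"
    using fin(2) ijk by (intro sum3_nonneg_eq_0[of Y d]) (auto simp: d_def intro!: sum_nonneg)
  then have "(det3 (r i) (r j) (r k) x y z)\<^sup>2 = 0" if "x \<in> X" "y \<in> X" "z \<in> X"
    using fin(1) that unfolding d_def by (intro sum3_nonneg_eq_0[of X "\<lambda>x y z. (det3 (r i) (r j) (r k) x y z)\<^sup>2"]) auto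
  \<comment> \<open>Columns outside \<open>X\<close> are zero, which extends the vanishing to all x,
    y, z.\<close>
  moreover have "r l x = 0" if "x \<notin> X" for l x
    using that R[of l] by (auto simp: r_def)
  ultimately have "det3 (r i) (r j) (r k) x y z = 0"
    by (cases "x \<in> X \<and> y \<in> X \<and> z \<in> X") (auto simp: det3_def)
  then show ?thesis by (simp add: r_def)
qed

section \<open>Set families of rank two\<close>

lemma sum_by_value:
  fixes g :: "'b \<Rightarrow> nat"
  assumes "finite Y" "finite S" "R ` Y \<subseteq> S"
  shows "(\<Sum>y\<in>Y. g (R y)) = (\<Sum>Z\<in>S. card {y \<in> Y. R y = Z} * g Z)"
proof -
  have "(\<Sum>y\<in>Y. g (R y)) = (\<Sum>Z\<in>S. \<Sum>y\<in>{y \<in> Y. R y = Z}. g (R y))"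
    using sum.group[OF assms, of "\<lambda>y. g (R y)"] by simp
  also have "\<dots> = (\<Sum>Z\<in>S. card {y \<in> Y. R y = Z} * g Z)"
    by (intro sum.cong) auto
  finally show ?thesis .
qed

lemma sum2_by_value:
  fixes h :: "'b \<Rightarrow> 'b \<Rightarrow> nat"
  assumes "finite Y" "finite S" "R ` Y \<subseteq> S"
  shows "(\<Sum>y\<in>Y. \<Sum>z\<in>Y. h (R y) (R z))
    = (\<Sum>P\<in>S. \<Sum>Q\<in>S. card {y \<in> Y. R y = P} * card {y \<in> Y. R y = Q} * h P Q)"
  using sum_by_value[OF assms, of "\<lambda>P. \<Sum>Q\<in>S. card {y \<in> Y. R y = Q} * h P Q"]
  by (simp add: sum_by_value[OF assms] sum_distrib_left mult.assoc)

text \<open>\<open>R y\<close> is a row of the biadjacency matrix, as a set of columns. The last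
  assumption says, without subtraction, that the second elementary symmetric function (p1^2 - p2) /
  2 of the intersection matrix is n.\<close>

locale set_family =
  fixes Y :: "'a set" and R :: "'a \<Rightarrow> 'b set" and n :: nat
  assumes finite_Y: "finite Y" and finite_R: "\<And>y. finite (R y)"
    and odd_n: "odd n"
    and sum_card: "(\<Sum>y\<in>Y. card (R y)) = n + 2"
    and sum_card_square: "(\<Sum>y\<in>Y. \<Sum>z\<in>Y. (card (R y \<inter> R z))\<^sup>2) + 2 * n = (n + 2)\<^sup>2"
begin

abbreviation occ :: "'b set \<Rightarrow> nat" where "occ Z \<equiv> card {y \<in> Y. R y = Z}"

text \<open>With a single nonempty row type the intersection matrix has rank at most one, so p2 =
  p1^2 and n = 0.\<close>

lemma two_types: "\<exists>y1\<in>Y. \<exists>y2\<in>Y. R y1 \<noteq> R y2 \<and> R y1 \<noteq> {} \<and> R y2 \<noteq> {}"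
proof (rule ccontr)
  assume *: "\<not> ?thesis"
  obtain y1 where y1: "y1 \<in> Y" "R y1 \<noteq> {}"
    using sum_card by (metis add_is_0 card.empty sum.neutral zero_neq_numeral)
  let ?S = "R y1"
  have S: "R ` Y \<subseteq> {{}, ?S}" using * y1 by blast
  have "occ ?S * card ?S = n + 2"
    using sum_by_value[OF finite_Y _ S, of card] y1 sum_card by simp
  moreover have "(occ ?S * card ?S)\<^sup>2 + 2 * n = (n + 2)\<^sup>2"
    using sum2_by_value[OF finite_Y _ S, of "\<lambda>P Q. (card (P \<inter> Q))\<^sup>2"] y1 sum_card_square
    by (simp add: power2_eq_square mult.assoc mult.left_commute)
  ultimately show False using odd_pos[OF odd_n] by simp
qed

text \<open>Two crossing row types make the graph a blown-up path on 5 vertices, with a, b, c, d, e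
  the class sizes in path order.\<close>

lemma not_crossing:
  assumes "y1 \<in> Y" "y2 \<in> Y" "R y1 - R y2 \<noteq> {}" "R y2 - R y1 \<noteq> {}" "R y1 \<inter> R y2 \<noteq> {}"
  shows "\<not> R ` Y \<subseteq> {{}, R y1, R y2}"
proof
  assume sub: "R ` Y \<subseteq> {{}, R y1, R y2}"
  let ?S = "R y1" and ?T = "R y2"
  define a where "a = card (?S - ?T)"
  define c where "c = card (?S \<inter> ?T)"
  define e where "e = card (?T - ?S)"
  define b where "b = occ ?S"
  define d where "d = occ ?T"
  have pos: "a > 0" "b > 0" "c > 0" "d > 0" "e > 0"
    using assms finite_Y finite_R by (auto simp: a_def b_def c_def d_def e_def card_gt_0_iff)
  have S: "card ?S = a + c" and T: "card ?T = c + e"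
    using card_Int_Diff[OF finite_R, of y1 ?T] card_Int_Diff[OF finite_R, of y2 ?S]
    by (simp_all add: a_def c_def e_def Int_commute)
  have ne: "?S \<noteq> ?T" "?S \<noteq> {}" "?T \<noteq> {}" using assms by auto
  have 1: "b * (a + c) + d * (c + e) = n + 2"
    using sum_by_value[OF finite_Y _ sub, of card] ne sum_card by (simp add: S T b_def d_def)
  have "(b * (a + c))\<^sup>2 + (d * (c + e))\<^sup>2 + 2 * b * d * c\<^sup>2 + 2 * n = (n + 2)\<^sup>2"
    using sum2_by_value[OF finite_Y _ sub, of "\<lambda>P Q. (card (P \<inter> Q))\<^sup>2"] ne sum_card_square
    by (simp add: S T power2_eq_square algebra_simps Int_commute[of ?T ?S] flip: b_def d_def c_def)
  \<comment> \<open>The square of the edge count minus the second power sum is 2 b d ((a + c) (c +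
    e) - c^2).\<close>
  then have "b * d * (a * c + a * e + c * e) = n"
    unfolding 1[symmetric] by (simp add: power2_eq_square algebra_simps)
  then show False using path5_blowup_arith[OF pos] 1 by simp
qed

text \<open>\<open>x0\<close> and \<open>y0\<close> are the adjacent centers, with leaves
  \<open>L\<close> and \<open>W\<close> respectively; either center may carry the single leaf.
  Isolated vertices are still allowed.\<close>

definition double_star_shape :: bool where
  "double_star_shape \<longleftrightarrow> (\<exists>x0 y0 W L. x0 \<notin> W \<and> y0 \<in> Y \<and> y0 \<notin> L \<and> L \<subseteq> Y \<and> R y0 = insert x0 W
     \<and> (\<forall>y\<in>L. R y = {x0}) \<and> (\<forall>y\<in>Y - insert y0 L. R y = {})
     \<and> (card L = 1 \<and> card W = n \<or> card L = n \<and> card W = 1))"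

lemma double_star_shapeI:
  assumes disj: "U \<inter> W = {}" and "W \<noteq> {}" and sub: "R ` Y \<subseteq> {{}, U, W, U \<union> W}"
    and k: "occ W = 0" "card U = 1" "occ (U \<union> W) = 1"
    and n: "occ U = 1 \<and> card W = n \<or> occ U = n \<and> card W = 1"
  shows double_star_shape
proof -
  obtain x0 where x0: "U = {x0}" using k(2) by (rule card_1_singletonE)
  obtain y0 where y0: "{y \<in> Y. R y = U \<union> W} = {y0}" using k(3) by (rule card_1_singletonE)
  have "R y \<noteq> W" if "y \<in> Y" for y using k(1) finite_Y that by auto
  moreover have "R y = U \<union> W \<longleftrightarrow> y = y0" if "y \<in> Y" for y using y0 that by auto
  moreover have "y0 \<in> Y" "R y0 = U \<union> W" using y0 by auto
  moreover from this have "R y0 \<noteq> U" using disj \<open>W \<noteq> {}\<close> by blast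
  ultimately show ?thesis
    unfolding double_star_shape_def using disj x0 sub n
    by (intro exI[of _ x0] exI[of _ y0] exI[of _ W] exI[of _ "{y \<in> Y. R y = U}"]) auto
qed

text \<open>\<open>U\<close> and \<open>W\<close> are atoms from which all rows are unions, so the
  multiplicities of three row types decide everything. The two outcomes of
  \<open>three_class_arith\<close> differ by exchanging \<open>U\<close> and
  \<open>W\<close>.\<close>

lemma laminar:
  assumes disj: "U \<inter> W = {}" and ne: "U \<noteq> {}" "W \<noteq> {}" and fin: "finite U" "finite W"
    and sub: "R ` Y \<subseteq> {{}, U, W, U \<union> W}"
  shows double_star_shape
proof -
  define u where "u = card U"
  define w where "w = card W"
  define k1 where "k1 = occ U"
  define k2 where "k2 = occ W"
  define k3 where "k3 = occ (U \<union> W)"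
  have uw: "card (U \<union> W) = u + w" using disj fin by (simp add: u_def w_def card_Un_disjoint)
  have pos: "u > 0" "w > 0" using ne fin by (auto simp: u_def w_def card_gt_0_iff)
  have dist: "U \<noteq> W" "U \<noteq> U \<union> W" "W \<noteq> U \<union> W" "W \<noteq> U" "U \<union> W \<noteq> U" "U \<union> W \<noteq> W" using disj ne by blast+
  have int: "U \<inter> (U \<union> W) = U" "W \<inter> (U \<union> W) = W" "(U \<union> W) \<inter> U = U" "(U \<union> W) \<inter> W = W" "W \<inter> U = {}"
    using disj by blast+
  have 1: "u * (k1 + k3) + w * (k2 + k3) = n + 2"
    using sum_by_value[OF finite_Y _ sub, of card] ne dist sum_card
    by (simp add: uw flip: u_def w_def k1_def k2_def k3_def) (simp add: algebra_simps)
  have "(k1 * u)\<^sup>2 + (k2 * w)\<^sup>2 + (k3 * (u + w))\<^sup>2 + 2 * k1 * k3 * u\<^sup>2 + 2 * k2 * k3 * w\<^sup>2 + 2 * n = (n + 2)\<^sup>2"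
    using sum2_by_value[OF finite_Y _ sub, of "\<lambda>P Q. (card (P \<inter> Q))\<^sup>2"] ne dist sum_card_square
    by (simp add: uw int disj flip: u_def w_def k1_def k2_def k3_def) (simp add: power2_eq_square algebra_simps)
  then have 2: "u * w * (k1 * k2 + k1 * k3 + k2 * k3) = n"
    unfolding 1[symmetric] by (simp add: power2_eq_square algebra_simps)
  from three_class_arith[OF pos 1 2 odd_n] show ?thesis
  proof (elim disjE)
    assume *: "k2 = 0 \<and> u = 1 \<and> k3 = 1 \<and> (k1 = 1 \<or> w = 1)"
    then have "k1 * w = n" using 2 by (simp add: mult.commute)
    then show ?thesis
      using * disj ne sub
      by (intro double_star_shapeI[of U W]) (auto simp: u_def w_def k1_def k2_def k3_def)
  next
    assume *: "k1 = 0 \<and> w = 1 \<and> k3 = 1 \<and> (k2 = 1 \<or> u = 1)"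
    then have "k2 * u = n" using 2 by (simp add: mult.commute)
    then show ?thesis
      using * disj ne sub
      by (intro double_star_shapeI[of W U]) (auto simp: u_def w_def k1_def k2_def k3_def Un_commute)
  qed
qed

text \<open>Two distinct nonempty rows determine the possible values of all others. Disjoint or
  nested rows yield two atoms for \<open>laminar\<close>.\<close>

lemma double_star_shape_if_rank_2:
  assumes det: "\<And>i j k x y z. i \<in> Y \<Longrightarrow> j \<in> Y \<Longrightarrow> k \<in> Y \<Longrightarrow>
    det3 (\<lambda>x. of_bool (x \<in> R i)) (\<lambda>x. of_bool (x \<in> R j)) (\<lambda>x. of_bool (x \<in> R k)) x y z = 0"
  shows double_star_shape
proof -
  obtain y1 y2 where y: "y1 \<in> Y" "y2 \<in> Y" and ne: "R y1 \<noteq> R y2" "R y1 \<noteq> {}" "R y2 \<noteq> {}"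
    using two_types by blast
  let ?S = "R y1" and ?T = "R y2"
  have types: "R y \<in> {{}, ?S, ?T} \<or> ?S \<inter> ?T = {} \<and> R y = ?S \<union> ?T
      \<or> ?T \<subseteq> ?S \<and> R y = ?S - ?T \<or> ?S \<subseteq> ?T \<and> R y = ?T - ?S" if "y \<in> Y" for y
    using dependent_set_triple[OF det[OF y(1) y(2) that] ne] .
  have fin: "finite ?S" "finite ?T" using finite_R by auto
  consider "?S \<inter> ?T = {}" | "?S \<subseteq> ?T" | "?T \<subseteq> ?S"
    | "?S - ?T \<noteq> {}" "?T - ?S \<noteq> {}" "?S \<inter> ?T \<noteq> {}" by blast
  then show ?thesis
  proof cases
    case 1
    show ?thesis by (rule laminar[of ?S ?T]) (use 1 ne fin types in blast)+
  next
    case 2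
    have "?S \<union> (?T - ?S) = ?T" using 2 by blast
    then show ?thesis
      by (intro laminar[of ?S "?T - ?S"]) (use 2 ne fin types in auto)
  next
    case 3
    have "?T \<union> (?S - ?T) = ?S" using 3 by blast
    then show ?thesis
      by (intro laminar[of ?T "?S - ?T"]) (use 3 ne fin types in auto)
  next
    case 4
    \<comment> \<open>The further alternatives in \<open>types\<close> require disjoint or nested
      sets.\<close>
    then have "R ` Y \<subseteq> {{}, ?S, ?T}" using types by blast
    then show ?thesis using not_crossing[OF y 4] by blast
  qed
qed

end

section \<open>Bipartite graphs\<close>

declare walks.simps(2) [simp del]

context pair_graph
begin

lemma finite_pverts [simp]: "finite (pverts G)"
  using finite_verts by simp

lemma arc_sym: "(u, v) \<in> parcs G \<longleftrightarrow> (v, u) \<in> parcs G"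
  using arcs_symmetric by blast

lemma arc_in_pverts:
  assumes "(u, v) \<in> parcs G"
  shows "u \<in> pverts G" "v \<in> pverts G"
  using wellformed[OF assms] by auto

lemma walks_1: "u \<in> pverts G \<Longrightarrow> walks G (Suc 0) u v = of_bool ((u, v) \<in> parcs G)"
  by (simp add: walks.simps(2))

lemma walks_add:
  assumes "v \<in> pverts G"
  shows "walks G (k + l) u v = (\<Sum>x\<in>pverts G. walks G k u x * walks G l x v)"
  using assms
proof (induction l arbitrary: v)
  case 0
  then show ?case by simp
next
  case (Suc l)
  have "walks G (k + Suc l) u v
      = (\<Sum>x\<in>pverts G. \<Sum>y\<in>pverts G. walks G k u y * (walks G l y x * of_bool ((x, v) \<in> parcs G)))"
    using Suc by (simp add: walks.simps(2) sum_distrib_right mult.assoc)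
  also have "\<dots> = (\<Sum>y\<in>pverts G. walks G k u y * walks G (Suc l) y v)"
    by (subst sum.swap) (simp only: walks.simps(2) sum_distrib_left)
  finally show ?case .
qed

lemma walks_trans:
  assumes "x \<in> pverts G" "v \<in> pverts G" "walks G k u x > 0" "walks G l x v > 0"
  shows "walks G (k + l) u v > 0"
proof -
  have "0 < walks G k u x * walks G l x v" using assms by simp
  also have "\<dots> \<le> walks G (k + l) u v"
    unfolding walks_add[OF assms(2)]
    by (rule member_le_sum[where f = "\<lambda>x. walks G k u x * walks G l x v"]) (use assms in auto)
  finally show ?thesis .
qed

lemma walks_Suc_pos:
  assumes "walks G k r u > 0" "(u, v) \<in> parcs G"
  shows "walks G (Suc k) r v > 0"
  using walks_trans[of u v k r "Suc 0"] assms by (simp add: arc_in_pverts walks_1)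

lemma walks_sym:
  assumes "u \<in> pverts G" "v \<in> pverts G"
  shows "walks G k u v = walks G k v u"
  using assms
proof (induction k arbitrary: v)
  case (Suc k)
  have "walks G (Suc k) u v = (\<Sum>x\<in>pverts G. walks G k u x * of_bool ((x, v) \<in> parcs G))"
    by (simp add: walks.simps(2))
  also have "\<dots> = (\<Sum>x\<in>pverts G. walks G (Suc 0) v x * walks G k x u)"
  proof (rule sum.cong[OF refl])
    fix x assume "x \<in> pverts G"
    then show "walks G k u x * of_bool ((x, v) \<in> parcs G) = walks G (Suc 0) v x * walks G k x u"
      using Suc.IH[of x] Suc.prems arc_sym[of x v] by (simp add: walks_1)
  qed
  also have "\<dots> = walks G (Suc k) v u"
    using walks_add[of u "Suc 0" k v] Suc.prems by simp
  finally show ?case .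
qed auto

text \<open>A vertex is put into \<open>X\<close> if it is joined by an even walk to the representative of its
  component; an arc inside one class would close up to an odd walk.\<close>

lemma bipartite_if_no_odd_closed_walks:
  assumes odd: "\<And>k. closed_walks G (2 * k + 1) = 0"
  shows "\<exists>X \<subseteq> pverts G. \<forall>(u, v) \<in> parcs G. u \<in> X \<longleftrightarrow> v \<notin> X"
proof -
  define conn where "conn = (\<lambda>u v. \<exists>k. walks G k u v > 0)"
  define c where "c = (\<lambda>v. SOME u. u \<in> pverts G \<and> conn u v)"
  define X where "X = {v \<in> pverts G. \<exists>k. walks G (2 * k) (c v) v > 0}"
  have no_odd: "walks G (2 * k + 1) u u = 0" if "u \<in> pverts G" for u k
    using odd[of k] that unfolding closed_walks_def by (subst (asm) sum_eq_0_iff) auto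
  have half: "u \<in> X \<longleftrightarrow> v \<notin> X" if uv: "(u, v) \<in> parcs G" for u v
  proof -
    have V: "u \<in> pverts G" "v \<in> pverts G" and vu: "(v, u) \<in> parcs G"
      using uv arc_sym by (auto dest: arc_in_pverts)
    have conn_iff: "conn w u \<longleftrightarrow> conn w v" for w
      using walks_Suc_pos uv vu unfolding conn_def by blast
    \<comment> \<open>Adjacent vertices are reached from the same vertices, so \<open>SOME\<close>
      is applied to the same predicate.\<close>
    then have c: "c u = c v" by (simp add: c_def)
    have "conn u u" by (auto simp: conn_def intro!: exI[of _ 0])
    then have r: "c u \<in> pverts G" "conn (c u) u"
      using someI[of "\<lambda>w. w \<in> pverts G \<and> conn w u" u] V by (auto simp: c_def)
    show ?thesis
    proof
      assume "u \<in> X"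
      show "v \<notin> X"
      proof
        assume "v \<in> X"
        then obtain k l where "walks G (2 * k) (c u) u > 0" and l: "walks G (2 * l) (c u) v > 0"
          using \<open>u \<in> X\<close> c by (auto simp: X_def)
        \<comment> \<open>An even walk from the representative to \<open>u\<close>, the arc to
          \<open>v\<close>, and an even walk back form an odd closed walk.\<close>
        from walks_Suc_pos[OF this(1) uv] have "walks G (Suc (2 * k)) (c u) v > 0" .
        moreover have "walks G (2 * l) v (c u) > 0"
          using l walks_sym[OF r(1) V(2)] by simp
        ultimately have "walks G (Suc (2 * k) + 2 * l) (c u) (c u) > 0"
          using walks_trans r V by blast
        then show False using no_odd[OF r(1), of "k + l"] by (simp add: algebra_simps)
      qed
    next
      assume "v \<notin> X"
      obtain k where k: "walks G k (c u) u > 0" using r by (auto simp: conn_def)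
      show "u \<in> X"
      proof (cases "even k")
        case True
        then show ?thesis using k V by (auto simp: X_def elim!: evenE)
      next
        case False
        then have "v \<in> X"
          using walks_Suc_pos[OF k uv] V c by (auto simp: X_def intro!: exI[of _ "Suc k div 2"])
        then show ?thesis using \<open>v \<notin> X\<close> by simp
      qed
    qed
  qed
  show ?thesis
    by (intro exI[of _ X]) (use half in \<open>auto simp: X_def\<close>)
qed

end

section \<open>Closed walks counted from one side of a bipartition\<close>

locale bipartite_pair_graph = pair_graph G for G :: "'a pair_pre_digraph" +
  fixes X Y :: "'a set"
  assumes pverts_eq: "pverts G = X \<union> Y" and disjoint: "X \<inter> Y = {}"
    and parcs_subset: "parcs G \<subseteq> X \<times> Y \<union> Y \<times> X"
begin

lemma finite_parts: "finite X" "finite Y"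
  using finite_pverts by (auto simp: pverts_eq)

lemma walks_parity:
  assumes "u \<in> pverts G" "walks G k u v > 0"
  shows "v \<in> pverts G \<and> (even k \<longleftrightarrow> (u \<in> X \<longleftrightarrow> v \<in> X))"
  using assms(2)
proof (induction k arbitrary: v)
  case 0
  then show ?case using assms(1) by (simp split: if_splits)
next
  case (Suc k)
  then have "(\<Sum>x\<in>pverts G. walks G k u x * of_bool ((x, v) \<in> parcs G)) \<noteq> 0"
    by (simp only: walks.simps(2))
  then obtain x where "walks G k u x * of_bool ((x, v) \<in> parcs G) \<noteq> 0"
    by (rule sum.not_neutral_contains_not_neutral)
  then have x: "walks G k u x > 0" "(x, v) \<in> parcs G" by (simp_all split: if_splits)
  then show ?case
    using Suc.IH[OF x(1)] parcs_subset disjoint pverts_eq by fastforce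
qed

lemma walks_eq_0:
  assumes "u \<in> pverts G" "even k \<longleftrightarrow> \<not> (u \<in> X \<longleftrightarrow> v \<in> X)"
  shows "walks G k u v = 0"
  using walks_parity[of u k v] assms by blast

lemma closed_walks_odd: "odd k \<Longrightarrow> closed_walks G k = 0"
  by (auto simp: closed_walks_def walks_eq_0)

text \<open>Moving the last arc of a closed walk based in \<open>Y\<close> to the front gives one
  based in \<open>X\<close>. Length 0 would compare the sizes of the sides, hence the form 2j +
  2.\<close>

lemma sum_walks_parts: "(\<Sum>y\<in>Y. walks G (Suc (Suc (2 * j))) y y) = (\<Sum>x\<in>X. walks G (Suc (Suc (2 * j))) x x)"
proof -
  have split: "(\<Sum>z\<in>pverts G. f z) = (\<Sum>x\<in>X. f x) + (\<Sum>y\<in>Y. f y)" for f :: "'a \<Rightarrow> nat"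
    unfolding pverts_eq using finite_parts disjoint by (rule sum.union_disjoint)
  have Y: "walks G (Suc (2 * j) + Suc 0) y y = (\<Sum>x\<in>X. walks G (Suc (2 * j)) y x * walks G (Suc 0) x y)"
    if "y \<in> Y" for y
  proof -
    have "(\<Sum>z\<in>Y. walks G (Suc (2 * j)) y z * walks G (Suc 0) z y) = 0"
      using that disjoint pverts_eq by (intro sum.neutral) (auto intro!: walks_eq_0)
    moreover have "y \<in> pverts G" using that pverts_eq by simp
    ultimately show ?thesis by (simp only: walks_add split add_0 add_0_right)
  qed
  have X: "walks G (Suc 0 + Suc (2 * j)) x x = (\<Sum>y\<in>Y. walks G (Suc 0) x y * walks G (Suc (2 * j)) y x)"
    if "x \<in> X" for x
  proof -
    have "(\<Sum>z\<in>X. walks G (Suc 0) x z * walks G (Suc (2 * j)) z x) = 0"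
      using that disjoint pverts_eq by (intro sum.neutral) (auto intro!: walks_eq_0)
    moreover have "x \<in> pverts G" using that pverts_eq by simp
    ultimately show ?thesis by (simp only: walks_add split add_0 add_0_right)
  qed
  have "(\<Sum>y\<in>Y. walks G (Suc (2 * j) + Suc 0) y y)
      = (\<Sum>y\<in>Y. \<Sum>x\<in>X. walks G (Suc (2 * j)) y x * walks G (Suc 0) x y)"
    using Y by (intro sum.cong) (auto)
  also have "\<dots> = (\<Sum>x\<in>X. \<Sum>y\<in>Y. walks G (Suc 0) x y * walks G (Suc (2 * j)) y x)"
    by (subst sum.swap) (simp add: mult.commute)
  also have "\<dots> = (\<Sum>x\<in>X. walks G (Suc 0 + Suc (2 * j)) x x)"
    using X by (intro sum.cong) (auto)
  finally show ?thesis by simp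
qed

lemma closed_walks_even:
  assumes "even k" "k > 0"
  shows "closed_walks G k = 2 * (\<Sum>y\<in>Y. walks G k y y)"
proof -
  obtain j where j: "k = Suc (Suc (2 * j))"
    using assms by (auto elim!: evenE) (metis Suc_pred mult_2 add_Suc_right add_Suc)
  have "closed_walks G k = (\<Sum>x\<in>X. walks G k x x) + (\<Sum>y\<in>Y. walks G k y y)"
    unfolding closed_walks_def pverts_eq using finite_parts disjoint by (rule sum.union_disjoint)
  then show ?thesis using sum_walks_parts[of j] j by simp
qed

definition nbrs :: "'a \<Rightarrow> 'a set" where
  "nbrs y = {x. (y, x) \<in> parcs G}"

lemma nbrs_subset: "y \<in> Y \<Longrightarrow> nbrs y \<subseteq> X"
  using parcs_subset disjoint by (auto simp: nbrs_def)

lemma finite_nbrs [simp]: "finite (nbrs y)"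
  by (rule finite_subset[OF _ finite_pverts]) (auto simp: nbrs_def dest: arc_in_pverts)

lemma walks_2:
  assumes "y \<in> pverts G"
  shows "walks G 2 y z = card (nbrs y \<inter> nbrs z)"
proof -
  have "walks G (Suc (Suc 0)) y z = (\<Sum>x\<in>pverts G. of_bool (x \<in> nbrs y \<inter> nbrs z))"
    using assms unfolding walks.simps(2)[of G "Suc 0"]
    by (intro sum.cong) (auto simp: walks_1 nbrs_def arc_sym)
  also have "\<dots> = card (pverts G \<inter> (nbrs y \<inter> nbrs z))"
    by (simp add: sum.If_cases of_bool_def Int_def)
  also have "pverts G \<inter> (nbrs y \<inter> nbrs z) = nbrs y \<inter> nbrs z"
    by (auto simp: nbrs_def dest: arc_in_pverts)
  finally show ?thesis by (simp add: numeral_2_eq_2)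
qed

lemma walks_add_even:
  assumes "y \<in> Y" "z \<in> Y" "even k"
  shows "walks G (k + l) y z = (\<Sum>w\<in>Y. walks G k y w * walks G l w z)"
proof -
  have "walks G (k + l) y z = (\<Sum>w\<in>pverts G. walks G k y w * walks G l w z)"
    using assms pverts_eq by (intro walks_add) simp
  also have "\<dots> = (\<Sum>w\<in>Y. walks G k y w * walks G l w z)"
    using assms pverts_eq disjoint finite_parts
    by (intro sum.mono_neutral_right) (auto intro!: walks_eq_0)
  finally show ?thesis .
qed

text \<open>Walks between vertices of \<open>Y\<close> are cut into steps of length two, counted by
  \<open>N\<close>, so the right sides are twice the traces of the powers of
  \<open>N\<close>.\<close>

lemma sum_closed_walks_part:
  defines "N \<equiv> \<lambda>y z. card (nbrs y \<inter> nbrs z)"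
  shows "closed_walks G 2 = 2 * (\<Sum>y\<in>Y. N y y)"
    and "closed_walks G 4 = 2 * (\<Sum>y\<in>Y. \<Sum>z\<in>Y. N y z * N z y)"
    and "closed_walks G 6 = 2 * (\<Sum>y\<in>Y. \<Sum>z\<in>Y. \<Sum>w\<in>Y. N y z * N z w * N w y)"
proof -
  have N: "walks G 2 y z = N y z" if "y \<in> Y" for y z
    using that by (simp add: N_def walks_2 pverts_eq)
  have N4: "walks G 4 y z = (\<Sum>w\<in>Y. N y w * N w z)" if "y \<in> Y" "z \<in> Y" for y z
    using walks_add_even[of y z 2 2] that by (simp add: N)
  have N6: "walks G 6 y z = (\<Sum>w\<in>Y. \<Sum>v\<in>Y. N y w * N w v * N v z)" if "y \<in> Y" "z \<in> Y" for y z
    using walks_add_even[of y z 2 4] that by (simp add: N N4 sum_distrib_left mult.assoc)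
  show "closed_walks G 2 = 2 * (\<Sum>y\<in>Y. N y y)"
    by (simp add: closed_walks_even N)
  show "closed_walks G 4 = 2 * (\<Sum>y\<in>Y. \<Sum>z\<in>Y. N y z * N z y)"
    by (simp add: closed_walks_even N4)
  show "closed_walks G 6 = 2 * (\<Sum>y\<in>Y. \<Sum>z\<in>Y. \<Sum>w\<in>Y. N y z * N z w * N w y)"
    by (simp add: closed_walks_even N6)
qed

end

section \<open>Double stars\<close>

lemma isomorphic_graphsI:
  assumes G: "pair_graph G" and inj: "inj_on f (pverts G)"
    and verts: "f ` pverts G = pverts H" and arcs: "map_prod f f ` parcs G = parcs H"
  shows "isomorphic_graphs G H"
proof -
  interpret pair_graph G by fact
  define h where "h = \<lparr> iso_verts = f, iso_arcs = map_prod f f, iso_head = snd, iso_tail = fst \<rparr>"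
  have "inj_on (map_prod f f) (parcs G)"
    by (rule inj_on_subset[OF map_prod_inj_on[OF inj inj]]) (auto dest: arc_in_pverts)
  then have "digraph_isomorphism h"
    using inj wf_digraph by (auto simp: digraph_isomorphism_def h_def)
  moreover have "with_proj H = app_iso h (with_proj G)"
    using verts arcs by (simp add: app_iso_def h_def with_proj_def)
  ultimately show ?thesis unfolding isomorphic_graphs_def digraph_iso_def by blast
qed

lemma image_map_prod_Times: "map_prod f g ` (A \<times> B) = f ` A \<times> g ` B"
  by (rule map_prod_surj_on) simp_all

lemma parcs_double_star:
  "parcs (double_star a b) = {(Inl 0, Inr 0), (Inr 0, Inl 0)} \<union> {Inl 0} \<times> Inl ` {1..a}
    \<union> Inl ` {1..a} \<times> {Inl 0} \<union> {Inr 0} \<times> Inr ` {1..b} \<union> Inr ` {1..b} \<times> {Inr 0}"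
  by (simp only: double_star_def star_def pair_pre_digraph.simps image_Un image_map_prod_Times
    image_insert image_empty Un_ac)

lemma isomorphic_double_starI:
  assumes G: "pair_graph G"
    and verts: "pverts G = {x0, y0} \<union> L \<union> W" and fin: "finite L" "finite W"
    and disj: "x0 \<noteq> y0" "x0 \<notin> L" "x0 \<notin> W" "y0 \<notin> L" "y0 \<notin> W" "L \<inter> W = {}"
    and arcs: "parcs G = {(x0, y0), (y0, x0)} \<union> {x0} \<times> L \<union> L \<times> {x0} \<union> {y0} \<times> W \<union> W \<times> {y0}"
  shows "isomorphic_graphs G (double_star (card L) (card W))"
proof -
  obtain l where l: "bij_betw l L {1..card L}"
    using finite_same_card_bij[OF fin(1), of "{1..card L}"] by auto
  obtain w where w: "bij_betw w W {1..card W}"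
    using finite_same_card_bij[OF fin(2), of "{1..card W}"] by auto
  define f where "f = (\<lambda>v. if v = x0 then Inl 0 else if v = y0 then Inr 0
    else if v \<in> L then Inl (l v) else Inr (w v))"
  have f: "f x0 = Inl 0" "f y0 = Inr 0" "\<And>v. v \<in> L \<Longrightarrow> f v = Inl (l v)" "\<And>v. v \<in> W \<Longrightarrow> f v = Inr (w v)"
    using disj by (auto simp: f_def)
  have fL: "f ` L = Inl ` {1..card L}" 
    using l f(3) by (auto simp: bij_betw_def image_image simp flip: image_image)
  have fW: "f ` W = Inr ` {1..card W}"
    using w f(4) by (auto simp: bij_betw_def image_image simp flip: image_image)
  have "inj_on f (pverts G)"
  proof (rule inj_onI)
    fix u v assume "u \<in> pverts G" "v \<in> pverts G" "f u = f v"
    moreover have "l u > 0" if "u \<in> L" for u using bij_betwE[OF l] that by fastforce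
    moreover have "w u > 0" if "u \<in> W" for u using bij_betwE[OF w] that by fastforce
    ultimately show "u = v"
      using f inj_onD[OF bij_betw_imp_inj_on[OF l], of u v] inj_onD[OF bij_betw_imp_inj_on[OF w], of u v]
      unfolding verts by (elim UnE insertE) force+
  qed
  moreover have "f ` pverts G = pverts (double_star (card L) (card W))"
    unfolding verts image_Un fL fW by (auto simp: f double_star_def star_def image_iff)
  moreover have "map_prod f f ` parcs G = parcs (double_star (card L) (card W))"
    by (simp only: arcs parcs_double_star image_Un image_map_prod_Times image_insert image_empty
      map_prod_simp f fL fW)
  ultimately show ?thesis by (rule isomorphic_graphsI[OF G])
qed

text \<open>Each center shares its class with the leaves of the other center.\<close>

lemma bipartite_double_star:
  "bipartite_pair_graph (double_star a b) (insert (Inl 0) (Inr ` {1..b})) (insert (Inr 0) (Inl ` {1..a}))"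
  unfolding bipartite_pair_graph_def bipartite_pair_graph_axioms_def
  using pair_graph_double_star[of a b] by (auto simp: double_star_def star_def image_iff Suc_le_eq)

lemma card_pverts_double_star: "card (pverts (double_star a b)) = a + b + 2"
proof -
  have "pverts (double_star a b) = Inl ` {0..a} \<union> Inr ` {0..b}"
    by (simp add: double_star_def star_def)
  then show ?thesis by (simp add: card_Plus flip: Plus_def)
qed

text \<open>On the two-element side, \<open>N\<close> is the 2 by 2 matrix with rows (n + 1, 1) and
  (1, 1).\<close>

lemma closed_walks_double_star:
  "closed_walks (double_star 1 n) 2 = 2 * (n + 2)"
  "closed_walks (double_star 1 n) 4 = 2 * ((n + 1)\<^sup>2 + 3)"
  "closed_walks (double_star 1 n) 6 = 2 * ((n + 1) ^ 3 + 3 * (n + 1) + 4)"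
proof -
  interpret bipartite_pair_graph "double_star 1 n" "insert (Inl 0) (Inr ` {1..n})" "{Inr 0, Inl 1}"
    using bipartite_double_star[of 1 n] by simp
  have 0: "nbrs (Inr 0) = insert (Inl 0) (Inr ` {1..n})" and 1: "nbrs (Inl 1) = {Inl 0}"
    unfolding nbrs_def by (auto simp: double_star_def star_def)
  have "card (nbrs (Inr 0)) = n + 1" unfolding 0
    by (subst card_insert_disjoint) (auto simp: card_image)
  moreover have "nbrs (Inr 0) \<inter> nbrs (Inl 1) = {Inl 0}" "nbrs (Inl 1) \<inter> nbrs (Inr 0) = {Inl 0}"
    using 0 1 by auto
  ultimately show "closed_walks (double_star 1 n) 2 = 2 * (n + 2)"
  "closed_walks (double_star 1 n) 4 = 2 * ((n + 1)\<^sup>2 + 3)"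
  "closed_walks (double_star 1 n) 6 = 2 * ((n + 1) ^ 3 + 3 * (n + 1) + 4)"
    unfolding sum_closed_walks_part using 1 by (simp_all add: power2_eq_square power3_eq_cube algebra_simps)
qed

section \<open>Reconstruction of the graph for odd n\<close>

lemma cospectral_double_star_isomorphic:
  assumes G: "pair_graph G" and cosp: "cospectral G (double_star 1 n)" and "odd n"
  shows "isomorphic_graphs G (double_star 1 n)"
proof -
  interpret pair_graph G by fact
  interpret H: bipartite_pair_graph "double_star 1 n" "insert (Inl 0) (Inr ` {1..n})"
    "insert (Inr 0) (Inl ` {1..1})"
    by (rule bipartite_double_star)
  have cw: "closed_walks G k = closed_walks (double_star 1 n) k" for k
    by (rule cospectral_closed_walks_eq[OF cosp finite_pverts H.finite_pverts])
  have "closed_walks G (2 * k + 1) = 0" for k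
    unfolding cw by (rule H.closed_walks_odd) simp
  from bipartite_if_no_odd_closed_walks[OF this]
  obtain X where X: "X \<subseteq> pverts G" "\<forall>(u, v) \<in> parcs G. u \<in> X \<longleftrightarrow> v \<notin> X"
    by blast
  define Y where "Y = pverts G - X"
  interpret B: bipartite_pair_graph G X Y
    by unfold_locales (use X arc_in_pverts in \<open>auto simp: Y_def\<close>)
  define N where "N = (\<lambda>y z. card (B.nbrs y \<inter> B.nbrs z))"
  have p: "(\<Sum>y\<in>Y. N y y) = n + 2" "(\<Sum>y\<in>Y. \<Sum>z\<in>Y. N y z * N z y) = (n + 1)\<^sup>2 + 3"
    "(\<Sum>y\<in>Y. \<Sum>z\<in>Y. \<Sum>w\<in>Y. N y z * N z w * N w y) = (n + 1) ^ 3 + 3 * (n + 1) + 4"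
    using B.sum_closed_walks_part closed_walks_double_star[of n] cw by (simp_all add: N_def)
  have sym: "N y z = N z y" for y z by (simp add: N_def Int_commute)
  interpret set_family Y B.nbrs n
  proof
    show "(\<Sum>y\<in>Y. card (B.nbrs y)) = n + 2" using p(1) by (simp add: N_def)
    have "(\<Sum>y\<in>Y. \<Sum>z\<in>Y. (card (B.nbrs y \<inter> B.nbrs z))\<^sup>2) = (n + 1)\<^sup>2 + 3"
      using p(2) sym by (simp add: N_def power2_eq_square)
    then show "(\<Sum>y\<in>Y. \<Sum>z\<in>Y. (card (B.nbrs y \<inter> B.nbrs z))\<^sup>2) + 2 * n = (n + 2)\<^sup>2"
      by (simp add: power2_eq_square)
  qed (use \<open>odd n\<close> B.finite_parts in auto)
  have double_star_shape
  proof (rule double_star_shape_if_rank_2)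
    fix i j k x y z assume ijk: "i \<in> Y" "j \<in> Y" "k \<in> Y"
    show "det3 (\<lambda>x. of_bool (x \<in> B.nbrs i)) (\<lambda>x. of_bool (x \<in> B.nbrs j))
        (\<lambda>x. of_bool (x \<in> B.nbrs k)) x y z = 0"
    proof (rule det3_eq_0_if_power_sums[OF finite_pverts B.finite_parts(2)])
      \<comment> \<open>All vertices serve as columns, because the inclusion is required for every
        y, and a y outside \<open>Y\<close> may have neighbours in \<open>Y\<close>.\<close>
      show "B.nbrs y \<subseteq> pverts G" for y by (auto simp: B.nbrs_def dest: arc_in_pverts)
      \<comment> \<open>The third elementary symmetric function vanishes for the double star, whose
        matrix has only two rows; here this is a polynomial identity in n.\<close>
      show "(\<Sum>i\<in>Y. card (B.nbrs i \<inter> B.nbrs i)) ^ 3 + 2 * (\<Sum>i\<in>Y. \<Sum>j\<in>Y. \<Sum>k\<in>Y.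
          card (B.nbrs i \<inter> B.nbrs j) * card (B.nbrs j \<inter> B.nbrs k) * card (B.nbrs k \<inter> B.nbrs i))
        = 3 * (\<Sum>i\<in>Y. card (B.nbrs i \<inter> B.nbrs i))
          * (\<Sum>i\<in>Y. \<Sum>j\<in>Y. card (B.nbrs i \<inter> B.nbrs j) * card (B.nbrs j \<inter> B.nbrs i))"
        using p unfolding N_def by (simp only:) (simp add: power2_eq_square power3_eq_cube algebra_simps)
    qed (rule ijk)+
  qed
  then obtain x0 y0 W L where shape: "x0 \<notin> W" "y0 \<in> Y" "y0 \<notin> L" "L \<subseteq> Y" "B.nbrs y0 = insert x0 W"
    "\<forall>y\<in>L. B.nbrs y = {x0}" "\<forall>y\<in>Y - insert y0 L. B.nbrs y = {}"
    and card: "card L = 1 \<and> card W = n \<or> card L = n \<and> card W = 1"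
    unfolding double_star_shape_def by blast
  have WX: "x0 \<in> X" "W \<subseteq> X" using B.nbrs_subset[OF shape(2)] shape(5) by auto
  have fin: "finite L" "finite W"
    using shape(4) WX B.finite_parts by (auto intro: finite_subset)
  have disj: "x0 \<noteq> y0" "x0 \<notin> L" "y0 \<notin> W" "L \<inter> W = {}"
    using WX shape B.disjoint by auto
  have YX: "(y, x) \<in> parcs G \<longleftrightarrow> y = y0 \<and> x \<in> insert x0 W \<or> y \<in> L \<and> x = x0" if "y \<in> Y" for x y
    using shape(3,5-7) that unfolding B.nbrs_def by (cases "y = y0"; cases "y \<in> L") auto
  have arcs: "parcs G = {(x0, y0), (y0, x0)} \<union> {x0} \<times> L \<union> L \<times> {x0} \<union> {y0} \<times> W \<union> W \<times> {y0}" (is "_ = ?A")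
  proof -
    have "(u, v) \<in> parcs G \<longleftrightarrow> (u, v) \<in> ?A" for u v
    proof (cases "u \<in> Y")
      case True
      then show ?thesis using YX[OF True, of v] WX B.disjoint shape(4) by auto
    next
      case False
      show ?thesis
      proof (cases "v \<in> Y")
        case True
        then show ?thesis using YX[OF True, of u] False WX B.disjoint shape(2,4) arc_sym[of u v] by auto
      next
        case v: False
        then show ?thesis using False B.parcs_subset shape(2,4) by auto
      qed
    qed
    then show ?thesis by (simp only: set_eq_iff split_paired_All simp_thms)
  qed
  \<comment> \<open>Closed walks of length 0 count vertices. The centers and leaves found already
    number n + 3, which excludes isolated vertices.\<close>
  have "card (pverts G) = card (pverts (double_star 1 n))"
    using cw[of 0] by (simp add: closed_walks_def)
  then have "card (pverts G) = n + 3" by (simp add: card_pverts_double_star)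
  moreover have "card ({x0, y0} \<union> L \<union> W) = n + 3"
    using card fin disj shape(1,3) by (subst card_Un_disjoint; auto simp: card_Un_disjoint)
  moreover have "{x0, y0} \<union> L \<union> W \<subseteq> pverts G"
    using WX shape(2,4) B.pverts_eq by auto
  ultimately have verts: "pverts G = {x0, y0} \<union> L \<union> W"
    by (metis card_subset_eq finite_pverts)
  show ?thesis
  proof (cases "card L = 1 \<and> card W = n")
    case True
    then show ?thesis using isomorphic_double_starI[OF G verts fin disj(1,2) shape(1,3) disj(3,4) arcs] by simp
  next
    case False
    \<comment> \<open>Now \<open>y0\<close> carries the single leaf, so the centers exchange
      roles.\<close>
    then have "card W = 1" "card L = n" using card by auto
    then show ?thesis
      using isomorphic_double_starI[OF G, of y0 x0 W L] verts arcs fin disj shape(1,3) by (simp add: insert_commute Un_ac Int_commute)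
  qed
qed

theorem theorem3p10:
  fixes n :: nat
  assumes "\<exists>G :: 'a pair_pre_digraph. pair_graph G \<and> cospectral G (double_star 1 n)
             \<and> \<not> isomorphic_graphs G (double_star 1 n)"
  shows "even n"
  using assms cospectral_double_star_isomorphic by blast

end
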